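(* Define a sequence of integers $(p_k)_{k\ge 1}$ recursively as follows. Let $p_1=2$, and for each $k\ge 1$, let $p_{k+1}$ be the least divisor exceeding $1$ of the integer $n^{n^n}-1$, where $n=p_1p_2\cdots p_k$. Then for each $k\ge 1$, the integer $p_k$ is the $k$-th smallest prime number.
   Context: The expression $n^{n^n}$ denotes the iterated power $n^{(n^n)}$. The primes are listed in increasing order starting from $2$, so the $1$st smallest prime is $2$, the $2$nd smallest is $3$, and so on. *)

theory Defs
  imports
    "HOL-Computational_Algebra.Primes"
    "HOL-Library.Infinite_Set"
begin

end

theory Submission
  imports Defs "HOL-Number_Theory.Residues"
begin

text \<open>
  Let \<open>n\<close> be the product of the primes below a prime \<open>q\<close>. No prime below \<open>q\<close> divides
  \<open>n ^ N - 1\<close>. As in Euclid's argument, a prime factor of \<open>n + 1\<close> is at least \<open>q\<close>, so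
  \<open>q - 1 \<le> n\<close>. All prime factors of \<open>q - 1\<close> divide \<open>n\<close>, and their exponents in \<open>q - 1\<close> are
  less than \<open>q - 1 \<le> n\<close>, so \<open>q - 1\<close> divides \<open>n ^ n\<close>. By Fermat's theorem \<open>q\<close> divides
  \<open>n ^ (n ^ n) - 1\<close>.
\<close>

text \<open>Compare multiplicities prime by prime: if \<open>r\<close> divides \<open>m\<close>, its
  exponent in \<open>m\<close> is below \<open>m \<le> N\<close>, while \<open>r ^ N\<close> already
  divides \<open>n ^ N\<close>.\<close>

lemma dvd_power_if_prime_factors_dvd:
  fixes m n :: nat
  assumes "m > 0" "n > 0" "m \<le> N"
    and prime_dvd: "\<And>r. prime r \<Longrightarrow> r dvd m \<Longrightarrow> r dvd n"
  shows "m dvd n ^ N"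
proof (rule multiplicity_le_imp_dvd)
  show "multiplicity r m \<le> multiplicity r (n ^ N)" if r: "prime r" for r
  proof (cases "r dvd m")
    case True
    have "multiplicity r m < r ^ multiplicity r m"
      using prime_gt_1_nat[OF r] by (simp add: power_gt_expt)
    also have "\<dots> \<le> m"
      using \<open>m > 0\<close> by (intro dvd_imp_le multiplicity_dvd)
    finally have "multiplicity r m \<le> N"
      using \<open>m \<le> N\<close> by simp
    moreover have "r ^ N dvd n ^ N"
      using prime_dvd[OF r True] by (rule dvd_power_same)
    then have "N \<le> multiplicity r (n ^ N)"
      using \<open>n > 0\<close> r by (intro multiplicity_geI) (auto dest: prime_gt_1_nat)
    ultimately show ?thesis
      by simp
  qed (simp add: not_dvd_imp_multiplicity_0)
qed (use \<open>m > 0\<close> in auto)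

lemma least_divisor_power_minus_one:
  fixes n q :: nat
  assumes q: "prime q" and "n > 0"
    and dvd_iff: "\<And>r. prime r \<Longrightarrow> r dvd n \<longleftrightarrow> r < q"
  shows "(LEAST d. d > 1 \<and> int d dvd int n ^ (n ^ n) - 1) = q"
proof (rule Least_equality)
  obtain r where r: "prime r" "r dvd n + 1"
    using \<open>n > 0\<close> prime_factor_nat[of "n + 1"] by auto
  then have "\<not> r dvd n"
    using dvd_diff_nat[of r "n + 1" n] by auto
  \<comment> \<open>\<open>dvd_iff\<close> turns \<open>\<not> r dvd n\<close> into
    \<open>q \<le> r\<close>, and \<open>r \<le> n + 1\<close>.\<close>
  then have "q \<le> n + 1"
    using dvd_iff[OF r(1)] dvd_imp_le[OF r(2)] by simp
  have "q - 1 dvd n ^ n"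
  proof (rule dvd_power_if_prime_factors_dvd)
    show "r dvd n" if "prime r" "r dvd q - 1" for r
      using dvd_iff[OF that(1)] dvd_imp_le[OF that(2)] prime_gt_1_nat[OF q] by simp
  qed (use prime_gt_1_nat[OF q] \<open>n > 0\<close> \<open>q \<le> n + 1\<close> in auto)
  then obtain c where c: "n ^ n = (q - 1) * c" ..
  have "\<not> q dvd n"
    using dvd_iff[OF q] by simp
  \<comment> \<open>Raise Fermat's congruence for \<open>n ^ (q - 1)\<close> to the power
    \<open>c\<close>.\<close>
  from fermat_theorem[OF q this] have "[n ^ (n ^ n) = 1] (mod q)"
    using cong_pow[of "n ^ (q - 1)" 1 q c] by (simp add: c power_mult)
  then have "[int n ^ (n ^ n) = 1] (mod int q)"
    using cong_int_iff[of "n ^ (n ^ n)" 1 q] by simp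
  then show "q > 1 \<and> int q dvd int n ^ (n ^ n) - 1"
    using prime_gt_1_nat[OF q] by (simp add: cong_iff_dvd_diff)
next
  fix d assume d: "d > 1 \<and> int d dvd int n ^ (n ^ n) - 1"
  then obtain r where r: "prime r" "r dvd d"
    using prime_factor_nat[of d] by auto
  \<comment> \<open>Otherwise \<open>r\<close> would divide two consecutive integers. Hence
    \<open>q \<le> r \<le> d\<close>.\<close>
  have "\<not> r dvd n"
  proof
    assume "r dvd n"
    then have "int r dvd int n ^ (n ^ n)"
      using \<open>n > 0\<close> by (auto intro: dvd_trans[OF _ dvd_power])
    moreover have "int r dvd int n ^ (n ^ n) - 1"
      using r(2) d by (auto intro: dvd_trans)
    ultimately have "int r dvd 1"
      using dvd_diff[of "int r" "int n ^ (n ^ n)" "int n ^ (n ^ n) - 1"] by simp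
    then show False
      using r(1) by simp
  qed
  then show "q \<le> d"
    using dvd_iff[OF r(1)] dvd_imp_le[OF r(2)] d by simp
qed

text \<open>The enumeration is strictly increasing and reaches every prime. This matches the bound
  \<open>r < q\<close> with the factors of the product of the earlier primes.\<close>

lemma prime_less_enumerate_iff:
  assumes "prime (r::nat)"
  shows "r < enumerate {q. prime q} k \<longleftrightarrow> (\<exists>j<k. r = enumerate {q. prime q} j)"
  using enumerate_Ex[of "{q::nat. prime q}" r] primes_infinite assms
  by auto

theorem theorem1:
  fixes p :: "nat \<Rightarrow> nat"
  assumes "p 1 = 2"
    and "\<And>k. k \<ge> 1 \<Longrightarrow>
           p (k + 1) = (let n = (\<Prod>i=1..k. p i)
                        in (LEAST d. d > 1 \<and> int d dvd int n ^ (n ^ n) - 1))"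
  shows "\<forall>k\<ge>1. p k = enumerate {q. prime q} (k - 1)"
proof -
  let ?e = "enumerate {q::nat. prime q}"
  have prime_e: "prime (?e j)" for j
    using enumerate_in_set[OF primes_infinite] by simp
  \<comment> \<open>\<open>p\<close> is indexed from 1 and \<open>?e\<close> from 0. Strong
    induction is used because \<open>n\<close> involves all earlier terms.\<close>
  have "p (Suc k) = ?e k" for k
  proof (induction k rule: less_induct)
    case (less k)
    show ?case
    proof (cases "k = 0")
      case True
      have "(LEAST q::nat. prime q) = 2"
        by (rule Least_equality) (auto dest: prime_ge_2_nat)
      then show ?thesis
        using True assms(1) by (simp add: enumerate_0)
    next
      case False
      define n where "n = (\<Prod>i=1..k. p i)"
      have n: "n = (\<Prod>j<k. ?e j)"
        using less.IH by (simp add: n_def prod.atLeast1_atMost_eq)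
      have "r dvd n \<longleftrightarrow> r < ?e k" if "prime r" for r
      proof -
        \<comment> \<open>Both are primes, so divisibility forces equality.\<close>
        have "r dvd ?e j \<longleftrightarrow> r = ?e j" for j
          using that prime_e primes_dvd_imp_eq by auto
        then show ?thesis
          using that by (auto simp: n prime_dvd_prod_iff prime_less_enumerate_iff)
      qed
      moreover have "n > 0"
        using prime_e by (auto simp: n intro!: prod_pos prime_gt_0_nat)
      ultimately have "(LEAST d. d > 1 \<and> int d dvd int n ^ (n ^ n) - 1) = ?e k"
        by (intro least_divisor_power_minus_one prime_e)
      then show ?thesis
        using assms(2)[of k, folded n_def] False by (simp add: Let_def)
    qed
  qed
  then show ?thesis
    by (metis Suc_diff_1 less_eq_Suc_le One_nat_def)
qed

end
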